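(* Let $n\geq 2$ be an integer. The semigroup $T_n(1)$ is a regular semigroup if and only if $n\in\{2,3,4,5\}$.
   Context: For an integer $n\geq 2$, $X_n=\{1,2,\dots,n\}$ and $T_n$ is the full transformation semigroup on $X_n$ (all functions $X_n\to X_n$ under composition). The image of $x$ under $\alpha$ is written $x\alpha$, and functions are composed from left to right: $x(\alpha\beta)=(x\alpha)\beta$. For an integer $l$ with $1\leq l\leq n-1$, $T_n(l)=\{\alpha\in T_n : \forall x,y\in X_n,\ |x-y|=l \Rightarrow |x\alpha-y\alpha|=l\}$, which is a subsemigroup of $T_n$; $T_n(1)$ is the case $l=1$. A semigroup $S$ is regular if for every $a\in S$ there exists $b\in S$ with $a=aba$. *)

theory Defs
  imports Main "HOL-Library.FuncSet"
begin

text \<open>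
  Semigroups are given by an explicit carrier set, since the locale \<open>semigroup\<close> of \<open>HOL.Groups\<close>
  only covers operations on a whole type.
\<close>

locale semigroup_on =
  fixes S :: "'a set" and mult :: "'a \<Rightarrow> 'a \<Rightarrow> 'a" (infixl \<open>\<cdot>\<close> 70)
  assumes closed: "a \<in> S \<Longrightarrow> b \<in> S \<Longrightarrow> a \<cdot> b \<in> S"
    and assoc: "a \<in> S \<Longrightarrow> b \<in> S \<Longrightarrow> c \<in> S \<Longrightarrow> (a \<cdot> b) \<cdot> c = a \<cdot> (b \<cdot> c)"

locale regular_semigroup = semigroup_on +
  assumes regular: "a \<in> S \<Longrightarrow> \<exists>b\<in>S. a = a \<cdot> b \<cdot> a"

definition X :: "nat \<Rightarrow> nat set" where
  "X n = {1..n}"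

text \<open>
  Maps of \<open>X n\<close> to itself are extensional (they have the value \<open>undefined\<close> outside \<open>X n\<close>), so
  that equality of elements of \<open>T n\<close> is equality on \<open>X n\<close>.
\<close>

definition T :: "nat \<Rightarrow> (nat \<Rightarrow> nat) set" where
  "T n = X n \<rightarrow>\<^sub>E X n"

text \<open>Products are read from left to right: \<open>tmult n \<alpha> \<beta>\<close> applies \<open>\<alpha>\<close> first.\<close>

definition tmult :: "nat \<Rightarrow> (nat \<Rightarrow> nat) \<Rightarrow> (nat \<Rightarrow> nat) \<Rightarrow> (nat \<Rightarrow> nat)" where
  "tmult n \<alpha> \<beta> = compose (X n) \<beta> \<alpha>"

text \<open>Distances are taken in \<open>int\<close> because subtraction on \<open>nat\<close> truncates.\<close>

definition T_dist :: "nat \<Rightarrow> nat \<Rightarrow> (nat \<Rightarrow> nat) set" where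
  "T_dist n l = {\<alpha> \<in> T n. \<forall>x\<in>X n. \<forall>y\<in>X n.
     \<bar>int x - int y\<bar> = int l \<longrightarrow> \<bar>int (\<alpha> x) - int (\<alpha> y)\<bar> = int l}"

lemma tmult_apply: "x \<in> X n \<Longrightarrow> tmult n \<alpha> \<beta> x = \<beta> (\<alpha> x)"
  by (simp add: tmult_def compose_def)

lemma semigroup_on_T: "semigroup_on (T n) (tmult n)"
proof
  show "tmult n a b \<in> T n" if "a \<in> T n" "b \<in> T n" for a b
    using that by (auto simp: T_def tmult_def compose_def)
  show "tmult n (tmult n a b) c = tmult n a (tmult n b c)"
    if "a \<in> T n" "b \<in> T n" "c \<in> T n" for a b c
    using that by (auto simp: T_def tmult_def compose_def fun_eq_iff)
qed

lemma semigroup_on_T_dist: "semigroup_on (T_dist n l) (tmult n)"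
proof
  interpret semigroup_on "T n" "tmult n" by (rule semigroup_on_T)
  show "tmult n a b \<in> T_dist n l" if "a \<in> T_dist n l" "b \<in> T_dist n l" for a b
  proof -
    have "a x \<in> X n" if "x \<in> X n" for x
      using that \<open>a \<in> T_dist n l\<close> by (auto simp: T_dist_def T_def)
    then show ?thesis
      using that closed by (simp add: T_dist_def tmult_apply)
  qed
  show "tmult n (tmult n a b) c = tmult n a (tmult n b c)"
    if "a \<in> T_dist n l" "b \<in> T_dist n l" "c \<in> T_dist n l" for a b c
    using that assoc by (simp add: T_dist_def)
qed

end

theory Submission
  imports Defs
begin

text \<open>
  An element of \<open>T_dist n 1\<close> is a walk with steps of length one, so its image is an interval
  \<open>{p..q}\<close>. A map \<open>\<beta>\<close> with \<open>\<alpha> = \<alpha> \<beta> \<alpha>\<close> is a section of \<open>\<alpha>\<close> over \<open>{p..q}\<close>, and such a section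
  exists precisely if some \<open>u\<close> and \<open>v\<close> at distance \<open>q - p\<close> are sent to \<open>p\<close> and \<open>q\<close>, that is, if
  \<open>\<alpha>\<close> traverses its image monotonically at some point. A walk on at most five points always does
  so. For \<open>n \<ge> 6\<close> the walk \<open>1, 2, 3, 2, 3, 4, 5, \<dots>, n - 2\<close> has to turn back between its only visit
  to \<open>1\<close> and its only visit to \<open>4\<close>.
\<close>

lemma T_dist_1_iff:
  "\<alpha> \<in> T_dist n 1 \<longleftrightarrow> \<alpha> \<in> T n \<and>
     (\<forall>x. 1 \<le> x \<and> x < n \<longrightarrow> \<bar>int (\<alpha> (Suc x)) - int (\<alpha> x)\<bar> = 1)"
  (is "?L \<longleftrightarrow> ?R")
proof
  show "?L \<Longrightarrow> ?R" by (auto simp: T_dist_def X_def)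
next
  assume R: ?R
  have "\<bar>int (\<alpha> x) - int (\<alpha> y)\<bar> = 1"
    if "x \<in> X n" "y \<in> X n" "\<bar>int x - int y\<bar> = 1" for x y
  proof -
    have "y = Suc x \<or> x = Suc y" using that(3) by linarith
    then show ?thesis
      using R that(1,2) by (fastforce simp: X_def abs_minus_commute)
  qed
  with R show ?L by (simp add: T_dist_def)
qed

lemma T_dist_in_X: "\<alpha> \<in> T_dist n l \<Longrightarrow> x \<in> X n \<Longrightarrow> \<alpha> x \<in> X n"
  by (auto simp: T_dist_def T_def)

text \<open>Every step changes the value by exactly one, so it also flips its parity: position and
  value stay in phase.\<close>

lemma walk_le:
  assumes "\<alpha> \<in> T_dist n 1" "1 \<le> x" "x + d \<le> n"
  shows "\<bar>int (\<alpha> (x + d)) - int (\<alpha> x)\<bar> \<le> int d \<and> even (\<alpha> (x + d) + \<alpha> x + d)"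
  using assms(3)
proof (induction d)
  case (Suc d)
  have "\<bar>int (\<alpha> (Suc (x + d))) - int (\<alpha> (x + d))\<bar> = 1"
    using assms(1)[unfolded T_dist_1_iff] assms(2) Suc.prems by simp
  then have "\<alpha> (Suc (x + d)) = Suc (\<alpha> (x + d)) \<or> \<alpha> (x + d) = Suc (\<alpha> (Suc (x + d)))"
    by linarith
  with Suc show ?case by auto
qed simp

lemma walk_dist_le:
  assumes "\<alpha> \<in> T_dist n 1" "x \<in> X n" "y \<in> X n"
  shows "\<bar>int (\<alpha> x) - int (\<alpha> y)\<bar> \<le> \<bar>int x - int y\<bar>"
    and "even (\<alpha> x + \<alpha> y + x + y)"
proof -
  have *: "\<bar>int (\<alpha> x) - int (\<alpha> y)\<bar> \<le> \<bar>int x - int y\<bar> \<and> even (\<alpha> x + \<alpha> y + x + y)"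
    if "x \<in> X n" "y \<in> X n" "x \<le> y" for x y
  proof -
    obtain d where "y = x + d" using \<open>x \<le> y\<close> le_Suc_ex by blast
    then show ?thesis
      using walk_le[OF assms(1), of x d] that by (auto simp: X_def abs_minus_commute)
  qed
  have "\<bar>int (\<alpha> x) - int (\<alpha> y)\<bar> \<le> \<bar>int x - int y\<bar> \<and> even (\<alpha> x + \<alpha> y + x + y)"
    using *[of x y] *[of y x] assms(2,3)
    by (cases "x \<le> y") (auto simp: abs_minus_commute)
  then show "\<bar>int (\<alpha> x) - int (\<alpha> y)\<bar> \<le> \<bar>int x - int y\<bar>" "even (\<alpha> x + \<alpha> y + x + y)"
    by auto
qed

text \<open>\<open>walk_dist_le\<close> leaves no slack between \<open>u\<close> and
  \<open>v\<close>, so \<alpha> is forced to be strictly monotone on that stretch. Its inverse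
  there, extended to all of \<open>X n\<close>, serves as \<beta>.\<close>

lemma regular_if_traversed:
  assumes \<alpha>: "\<alpha> \<in> T_dist n 1" and uv: "u \<in> X n" "v \<in> X n" and "\<alpha> u < \<alpha> v"
    and dist: "\<bar>int u - int v\<bar> = int (\<alpha> v) - int (\<alpha> u)"
    and image: "\<alpha> ` X n \<subseteq> {\<alpha> u..\<alpha> v}"
  shows "\<exists>\<beta>\<in>T_dist n 1. \<alpha> = tmult n (tmult n \<alpha> \<beta>) \<alpha>"
proof -
  let ?p = "\<alpha> u" and ?q = "\<alpha> v"
  \<comment> \<open>\<open>g i\<close> lies \<open>i\<close> steps from \<open>u\<close> towards
    \<open>v\<close>; \<open>f\<close> below folds \<open>X n\<close> onto the offsets
    \<open>i\<close>.\<close>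
  define g where "g i = (if u \<le> v then u + i else u - i)" for i
  \<comment> \<open>Outside \<open>{\<alpha> u..\<alpha> v}\<close> the section oscillates between the last two values at the nearer end.\<close>
  define f where "f y = (if y < ?p then (?p - y) mod 2 else if y \<le> ?q then y - ?p
    else ?q - ?p - (y - ?q) mod 2)" for y
  define \<beta> where "\<beta> = restrict (\<lambda>y. g (f y)) (X n)"
  \<comment> \<open>Since \<open>?p < ?q\<close>, there are at least two offsets, so the oscillation
    has room.\<close>
  have f_le: "f y \<le> ?q - ?p" for y
    using \<open>?p < ?q\<close> mod_less_divisor[of 2 "?p - y"] by (auto simp: f_def)
  have f_step: "f (Suc y) = Suc (f y) \<or> f y = Suc (f (Suc y))" for y
  proof -
    have mod2: "m mod 2 = 0 \<and> Suc m mod 2 = 1 \<or> m mod 2 = 1 \<and> Suc m mod 2 = 0" for m :: nat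
      by presburger
    consider "Suc y < ?p" | "Suc y = ?p" | "?p \<le> y" "y < ?q" | "?q \<le> y" by linarith
    then show ?thesis
    proof cases
      case 1
      then have "?p - y = Suc (?p - Suc y)" by simp
      then show ?thesis
        using 1 mod2[of "?p - Suc y"] by (auto simp: f_def)
    next
      case 4
      then have "f y = ?q - ?p - (y - ?q) mod 2" "f (Suc y) = ?q - ?p - Suc (y - ?q) mod 2"
        using \<open>?p < ?q\<close> by (auto simp: f_def Suc_diff_le)
      then show ?thesis using \<open>?p < ?q\<close> mod2[of "y - ?q"] by linarith
    qed (use \<open>?p < ?q\<close> in \<open>auto simp: f_def\<close>)
  qed
  have g_in: "g i \<in> X n" if "i \<le> ?q - ?p" for i
    using that uv dist \<open>?p < ?q\<close> by (auto simp: g_def X_def)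
  have g_step: "\<bar>int (g (Suc i)) - int (g i)\<bar> = 1" if "Suc i \<le> ?q - ?p" for i
    using that dist by (auto simp: g_def)
  have \<alpha>g: "\<alpha> (g i) = ?p + i" if "i \<le> ?q - ?p" for i
  proof -
    \<comment> \<open>The distances to \<open>u\<close> and \<open>v\<close> add up to
      \<open>?q - ?p\<close>, so the two bounds meet in a single value.\<close>
    have "\<bar>int (g i) - int u\<bar> = int i" "\<bar>int (g i) - int v\<bar> = int ?q - int ?p - int i"
      using that dist by (auto simp: g_def)
    then have "\<bar>int (\<alpha> (g i)) - int ?p\<bar> \<le> int i"
      "\<bar>int (\<alpha> (g i)) - int ?q\<bar> \<le> int ?q - int ?p - int i"
      using walk_dist_le(1)[OF \<alpha> g_in[OF that] uv(1)] walk_dist_le(1)[OF \<alpha> g_in[OF that] uv(2)]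
      by simp_all
    then show ?thesis by linarith
  qed
  have "\<beta> \<in> T_dist n 1"
    unfolding T_dist_1_iff
  proof (intro conjI allI impI)
    show "\<beta> \<in> T n" using g_in f_le by (auto simp: \<beta>_def T_def)
  next
    fix x assume x: "1 \<le> x \<and> x < n"
    then have "\<beta> x = g (f x)" "\<beta> (Suc x) = g (f (Suc x))"
      by (simp_all add: \<beta>_def X_def)
    then show "\<bar>int (\<beta> (Suc x)) - int (\<beta> x)\<bar> = 1"
      using f_step[of x] f_le[of x] f_le[of "Suc x"] g_step[of "f x"] g_step[of "f (Suc x)"]
      by (auto simp: abs_minus_commute)
  qed
  moreover have "\<alpha> x = tmult n (tmult n \<alpha> \<beta>) \<alpha> x" for x
  proof (cases "x \<in> X n")
    case True
    then have "\<alpha> x \<in> {?p..?q}" "\<alpha> x \<in> X n" using image T_dist_in_X[OF \<alpha>] by auto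
    then show ?thesis
      using True \<alpha>g[of "\<alpha> x - ?p"] by (auto simp: tmult_apply \<beta>_def f_def)
  next
    \<comment> \<open>Both sides are \<open>undefined\<close> here.\<close>
    case False
    then show ?thesis
      using \<alpha> by (auto simp: tmult_def compose_def T_dist_def T_def PiE_def extensional_def)
  qed
  ultimately show ?thesis by (intro bexI[of _ \<beta>] ext)
qed

lemma traversed_if_le_5:
  assumes \<alpha>: "\<alpha> \<in> T_dist n 1" and n: "2 \<le> n" "n \<le> 5"
  obtains u v where "u \<in> X n" "v \<in> X n" "\<alpha> u < \<alpha> v"
    "\<bar>int u - int v\<bar> = int (\<alpha> v) - int (\<alpha> u)" "\<alpha> ` X n \<subseteq> {\<alpha> u..\<alpha> v}"
proof -
  define p q where "p = Min (\<alpha> ` X n)" and "q = Max (\<alpha> ` X n)"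
  have fin: "finite (\<alpha> ` X n)" "\<alpha> ` X n \<noteq> {}" using n by (auto simp: X_def)
  obtain x y where xy: "x \<in> X n" "\<alpha> x = p" "y \<in> X n" "\<alpha> y = q"
    using Min_in[OF fin] Max_in[OF fin] unfolding p_def q_def by fastforce
  have image: "p \<le> \<alpha> z \<and> \<alpha> z \<le> q" if "z \<in> X n" for z
    using fin that by (simp add: p_def q_def)
  have X12: "1 \<in> X n" "2 \<in> X n" using n by (auto simp: X_def)
  have step: "\<bar>int (\<alpha> 2) - int (\<alpha> 1)\<bar> = 1"
    using \<alpha> n unfolding T_dist_1_iff by (metis One_nat_def Suc_1 Suc_le_eq le_refl)
  have "p < q" using image[OF X12(1)] image[OF X12(2)] step by linarith
  have le: "\<bar>int p - int q\<bar> \<le> \<bar>int x - int y\<bar>" and par: "even (p + q + x + y)"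
    using walk_dist_le[OF \<alpha> xy(1,3)] xy(2,4) by simp_all
  have rng: "1 \<le> x" "x \<le> 5" "1 \<le> y" "y \<le> 5" using xy n by (auto simp: X_def)
  \<comment> \<open>The separation of \<open>x\<close> and \<open>y\<close> is at most 4, at least
    \<open>q - p\<close>, and of the same parity. This leaves two cases in which another pair must
    be found.\<close>
  have "\<bar>int x - int y\<bar> = int q - int p
      \<or> \<bar>int x - int y\<bar> = 3 \<and> q = p + 1 \<or> \<bar>int x - int y\<bar> = 4 \<and> q = p + 2"
  proof -
    define d e where "d = \<bar>int x - int y\<bar>" and "e = int q - int p"
    have "1 \<le> e" "e \<le> d" "d \<le> 4" using le rng \<open>p < q\<close> by (auto simp: d_def e_def)
    moreover have "even (d + e)" using par unfolding d_def e_def by presburger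
    ultimately have "d = e \<or> d = 3 \<and> e = 1 \<or> d = 4 \<and> e = 2" by presburger
    then show ?thesis by (auto simp: d_def e_def)
  qed
  then have "\<exists>u\<in>X n. \<exists>v\<in>X n. \<alpha> u = p \<and> \<alpha> v = q \<and> \<bar>int u - int v\<bar> = int q - int p"
  proof (elim disjE conjE)
    assume "\<bar>int x - int y\<bar> = int q - int p"
    then show ?thesis using xy by blast
  next
    \<comment> \<open>With only two values, any single step traverses the image.\<close>
    assume q: "q = p + 1"
    have "\<alpha> 1 = p \<and> \<alpha> 2 = q \<or> \<alpha> 2 = p \<and> \<alpha> 1 = q"
      using image[OF X12(1)] image[OF X12(2)] step q by linarith
    then show ?thesis
    proof
      assume "\<alpha> 1 = p \<and> \<alpha> 2 = q"
      then show ?thesis using X12 q by (intro bexI[of _ 1] bexI[of _ 2]) auto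
    next
      assume "\<alpha> 2 = p \<and> \<alpha> 1 = q"
      then show ?thesis using X12 q by (intro bexI[of _ 2] bexI[of _ 1]) auto
    qed
  next
    \<comment> \<open>Here \<open>x\<close> and \<open>y\<close> are the end points \<open>1\<close> and \<open>5\<close>, and by parity the midpoint is sent to
      \<open>p\<close> or to \<open>q\<close>.\<close>
    assume d: "\<bar>int x - int y\<bar> = 4" and q: "q = p + 2"
    have ends: "x = 1 \<and> y = 5 \<or> x = 5 \<and> y = 1" using d rng by linarith
    have X3: "3 \<in> X n" using xy ends by (auto simp: X_def)
    have "even (\<alpha> 3 + p + 3 + x)" using walk_dist_le(2)[OF \<alpha> X3 xy(1)] xy(2) by simp
    then have "even (\<alpha> 3 + p)" using ends by auto
    then have "\<alpha> 3 = p \<or> \<alpha> 3 = q" using image[OF X3] q by presburger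
    then show ?thesis
    proof
      assume "\<alpha> 3 = p"
      then show ?thesis using X3 xy ends q by (intro bexI[of _ 3] bexI[of _ y]) auto
    next
      assume "\<alpha> 3 = q"
      then show ?thesis using X3 xy ends q by (intro bexI[of _ x] bexI[of _ 3]) auto
    qed
  qed
  then show thesis using that \<open>p < q\<close> image by (metis atLeastAtMost_iff image_subsetI)
qed

lemma not_regular_if_ge_6:
  assumes "6 \<le> n"
  obtains \<alpha> where "\<alpha> \<in> T_dist n 1" "\<And>\<beta>. \<beta> \<in> T_dist n 1 \<Longrightarrow> \<alpha> \<noteq> tmult n (tmult n \<alpha> \<beta>) \<alpha>"
proof
  \<comment> \<open>The shift by 2 inserts the detour 3, 2, 3; the value 4 is then reached only at
    position 6, whence \<open>6 \<le> n\<close>.\<close>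
  define \<alpha> where "\<alpha> = restrict (\<lambda>x. if x \<le> 3 then x else x - 2) (X n)"
  show \<alpha>: "\<alpha> \<in> T_dist n 1"
    unfolding T_dist_1_iff using assms by (auto simp: T_def \<alpha>_def X_def)
  show "\<alpha> \<noteq> tmult n (tmult n \<alpha> \<beta>) \<alpha>" if \<beta>: "\<beta> \<in> T_dist n 1" for \<beta>
  proof
    assume eq: "\<alpha> = tmult n (tmult n \<alpha> \<beta>) \<alpha>"
    have X: "1 \<in> X n" "4 \<in> X n" "6 \<in> X n" using assms by (auto simp: X_def)
    have "\<alpha> 1 = 1" "\<alpha> 6 = 4" using X by (simp_all add: \<alpha>_def)
    moreover have "\<alpha> x = \<alpha> (\<beta> (\<alpha> x))" if "x \<in> X n" for x
      using eq that by (metis tmult_apply)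
    ultimately have "\<alpha> (\<beta> 1) = 1" "\<alpha> (\<beta> 4) = 4" using X by metis+
    \<comment> \<open>The values 1 and 4 have the unique preimages 1 and 6, so \<beta> would stretch
      distance 3 to distance 5.\<close>
    then have "\<beta> 1 = 1" "\<beta> 4 = 6"
      using T_dist_in_X[OF \<beta> X(1)] T_dist_in_X[OF \<beta> X(2)]
      by (auto simp: \<alpha>_def X_def split: if_splits)
    then show False using walk_dist_le(1)[OF \<beta> X(1,2)] by simp
  qed
qed

theorem theorem2p1:
  fixes n :: nat
  assumes "n \<ge> 2"
  shows "regular_semigroup (T_dist n 1) (tmult n) \<longleftrightarrow> n \<in> {2, 3, 4, 5}"
proof
  assume reg: "regular_semigroup (T_dist n 1) (tmult n)"
  have "n \<le> 5"
  proof (rule ccontr)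
    assume "\<not> n \<le> 5"
    then obtain \<alpha> where "\<alpha> \<in> T_dist n 1"
      "\<And>\<beta>. \<beta> \<in> T_dist n 1 \<Longrightarrow> \<alpha> \<noteq> tmult n (tmult n \<alpha> \<beta>) \<alpha>"
      using not_regular_if_ge_6[of n] by auto
    then show False using regular_semigroup.regular[OF reg] by blast
  qed
  with assms show "n \<in> {2, 3, 4, 5}" by auto
next
  assume "n \<in> {2, 3, 4, 5}"
  then have "n \<le> 5" by auto
  interpret semigroup_on "T_dist n 1" "tmult n" by (rule semigroup_on_T_dist)
  show "regular_semigroup (T_dist n 1) (tmult n)"
  proof
    show "\<exists>\<beta>\<in>T_dist n 1. \<alpha> = tmult n (tmult n \<alpha> \<beta>) \<alpha>" if "\<alpha> \<in> T_dist n 1" for \<alpha>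
      using traversed_if_le_5[OF that assms \<open>n \<le> 5\<close>] regular_if_traversed[OF that] by metis
  qed
qed

end
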